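(* Let $w\in S_n$ and let $$M_w=\{m_{i,x}(w) : i\in[n] \text{ and } x\in[c_i(w)]\},\qquad C_i(w)=\{m_{i,x}(w) : x\in[c_i(w)]\},$$ where $M_w$ is ordered by the restriction of $\leq_S$. (a) The set of join-irreducibles of the lattice $(\boldsymbol{c}(\Lambda_w),\leq_S)$ is $M_w$. (b) As distributive lattices, $(J(M_w),\subseteq)\cong(\boldsymbol{c}(\Lambda_w),\leq_S)$. (c) If $i<j$ and $m_{i,x}(w)$, $m_{j,y}(w)$ are defined (i.e. $i,j\in[n]$, $x\in[c_i(w)]$, $y\in[c_j(w)]$), then $m_{i,x}(w)\not\leq_S m_{j,y}(w)$. (d) If $(i,j)\in\mathrm{Inv}(w)$, then every element of $C_i(w)$ is incomparable (with respect to $\leq_S$) with every element of $C_j(w)$. (e) If $(i,j)\in\overline{\mathrm{Inv}}(w)$, $x\in[c_i(w)]$, and $y\in[c_j(w)]$, then $$m_{j,y}(w)\leq_S m_{i,x}(w)\iff y\leq x-c_{i,j}(w).$$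
   Context: Here $n$ is a positive integer, $[m]=\{1,\ldots,m\}$ (so $[0]=\emptyset$), $\mathbb{N}=\{0,1,2,\ldots\}$, and $S_n$ is the symmetric group on $[n]$, with product $(uv)(k)=u(v(k))$. For $w\in S_n$, $\mathrm{Inv}(w)=\{(i,j)\in[n]\times[n] : i<j \text{ and } w(i)>w(j)\}$ and $\ell(w)=|\mathrm{Inv}(w)|$. Regarding $w$ as a permutation in $S_{n+1}$ with $w(n+1)=n+1$, the set of non-inversions is $\overline{\mathrm{Inv}}(w)=\{(i,j)\in[n]\times[n+1] : i\leq j \text{ and } w(i)\leq w(j)\}$. The left weak order $\leq_L$ on $S_n$ is the (reflexive) transitive closure of the relations $v\leq_L w$ whenever $w=s_iv$ and $\ell(w)=\ell(v)+1$, where $s_i=(i\;\;i+1)$. Write $\Lambda_w=\{v\in S_n : v\leq_L w\}$. The Lehmer code of $w$ is $\boldsymbol{c}(w)=(c_1(w),\ldots,c_n(w))\in\mathbb{N}^n$, where $c_i(w)=|\{k : (i,k)\in\mathrm{Inv}(w)\}|$; by convention $c_{n+1}(w)=0$. The extended Lehmer code is given by $c_{i,j}(w)=|\{k : k<j \text{ and } (i,k)\in\mathrm{Inv}(w)\}|$ for $i\in[n]$, $j\in[n+1]$ (so $c_{i,j}(w)=0$ if $j\leq i$). The set $\boldsymbol{c}(\Lambda_w)=\{\boldsymbol{c}(v) : v\in\Lambda_w\}\subseteq\mathbb{N}^n$ is ordered by the product order $\leq_S$ of $\mathbb{N}^n$ ($\boldsymbol{x}\leq_S\boldsymbol{y}$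 iff $x_i\leq y_i$ for all $i\in[n]$); under this order it is a distributive lattice (a sublattice of $\mathbb{N}^n$, with coordinatewise max and min as join and meet) with least element $(0,\ldots,0)$. Let $\pi_j(\boldsymbol{x})$ denote the $j$-th coordinate of $\boldsymbol{x}\in\mathbb{N}^n$. For $i\in[n]$ and $x\in[c_i(w)]$, the element $m_{i,x}(w)\in\mathbb{N}^n$ is defined by, for $j\in[n]$: $\pi_j(m_{i,x}(w))=0$ if $j<i$; $\pi_j(m_{i,x}(w))=0$ if $(i,j)\in\mathrm{Inv}(w)$; and $\pi_j(m_{i,x}(w))=\max\{0,x-c_{i,j}(w)\}$ if $(i,j)\in\overline{\mathrm{Inv}}(w)$. A join-irreducible of a finite lattice $L$ is an element $z\in L$, different from the least element, such that $z=x\vee y$ with $x,y\in L$ implies $x=z$ or $y=z$. For a finite poset $P$, $J(P)$ denotes the set of order ideals (down-closed subsets) of $P$, ordered by inclusion. *)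

theory Defs
  imports "HOL-Combinatorics.Permutations" "HOL-Algebra.Lattice"
begin

text \<open>
  Elements of \<open>S_n\<close> are functions \<open>w\<close> with \<open>w permutes {1..n}\<close>; as such a function is the
  identity outside \<open>{1..n}\<close>, the convention \<open>w (n + 1) = n + 1\<close> holds automatically.
  Elements of \<open>\<nat>\<^sup>n\<close> are functions \<open>nat \<Rightarrow> nat\<close> vanishing outside \<open>{1..n}\<close>.
\<close>

definition Inv :: "nat \<Rightarrow> (nat \<Rightarrow> nat) \<Rightarrow> (nat \<times> nat) set" where
  "Inv n w = {(i, j). i \<in> {1..n} \<and> j \<in> {1..n} \<and> i < j \<and> w i > w j}"

definition nonInv :: "nat \<Rightarrow> (nat \<Rightarrow> nat) \<Rightarrow> (nat \<times> nat) set" where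
  "nonInv n w = {(i, j). i \<in> {1..n} \<and> j \<in> {1..n + 1} \<and> i \<le> j \<and> w i \<le> w j}"

definition perm_length :: "nat \<Rightarrow> (nat \<Rightarrow> nat) \<Rightarrow> nat" where
  "perm_length n w = card (Inv n w)"

definition left_weak_step :: "nat \<Rightarrow> (nat \<Rightarrow> nat) \<Rightarrow> (nat \<Rightarrow> nat) \<Rightarrow> bool" where
  "left_weak_step n v w \<longleftrightarrow> v permutes {1..n} \<and> w permutes {1..n} \<and>
     (\<exists>i. 1 \<le> i \<and> i < n \<and> w = Transposition.transpose i (i + 1) \<circ> v) \<and>
     perm_length n w = perm_length n v + 1"

definition left_weak_le :: "nat \<Rightarrow> (nat \<Rightarrow> nat) \<Rightarrow> (nat \<Rightarrow> nat) \<Rightarrow> bool" where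
  "left_weak_le n = (left_weak_step n)\<^sup>*\<^sup>*"

definition Lambda :: "nat \<Rightarrow> (nat \<Rightarrow> nat) \<Rightarrow> (nat \<Rightarrow> nat) set" where
  "Lambda n w = {v. v permutes {1..n} \<and> left_weak_le n v w}"

text \<open>
  The Lehmer code vanishes outside \<open>{1..n}\<close>, so in particular \<open>lehmer n w (n + 1) = 0\<close>.
\<close>

definition lehmer :: "nat \<Rightarrow> (nat \<Rightarrow> nat) \<Rightarrow> (nat \<Rightarrow> nat)" where
  "lehmer n w = (\<lambda>i. card {k. (i, k) \<in> Inv n w})"

definition lehmer_ext :: "nat \<Rightarrow> (nat \<Rightarrow> nat) \<Rightarrow> nat \<Rightarrow> nat \<Rightarrow> nat" where
  "lehmer_ext n w i j = card {k. k < j \<and> (i, k) \<in> Inv n w}"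

definition le_S :: "nat \<Rightarrow> (nat \<Rightarrow> nat) \<Rightarrow> (nat \<Rightarrow> nat) \<Rightarrow> bool" where
  "le_S n x y \<longleftrightarrow> (\<forall>i \<in> {1..n}. x i \<le> y i)"

definition order_S :: "nat \<Rightarrow> (nat \<Rightarrow> nat) set \<Rightarrow> (nat \<Rightarrow> nat) gorder" where
  "order_S n A = \<lparr>carrier = A, eq = (=), le = le_S n\<rparr>"

definition code_lattice :: "nat \<Rightarrow> (nat \<Rightarrow> nat) \<Rightarrow> (nat \<Rightarrow> nat) gorder" where
  "code_lattice n w = order_S n (lehmer n ` Lambda n w)"

text \<open>
  In the last case below \<open>(i, j)\<close> is a non-inversion (for \<open>i \<in> {1..n}\<close>), and truncated
  subtraction on \<open>nat\<close> gives \<open>max {0, x - lehmer_ext n w i j}\<close>.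
\<close>

definition m_elem :: "nat \<Rightarrow> (nat \<Rightarrow> nat) \<Rightarrow> nat \<Rightarrow> nat \<Rightarrow> (nat \<Rightarrow> nat)" where
  "m_elem n w i x = (\<lambda>j.
     if j \<notin> {1..n} \<or> j < i then 0
     else if (i, j) \<in> Inv n w then 0
     else x - lehmer_ext n w i j)"

definition C_chain :: "nat \<Rightarrow> (nat \<Rightarrow> nat) \<Rightarrow> nat \<Rightarrow> (nat \<Rightarrow> nat) set" where
  "C_chain n w i = {m_elem n w i x | x. x \<in> {1..lehmer n w i}}"

definition M_set :: "nat \<Rightarrow> (nat \<Rightarrow> nat) \<Rightarrow> (nat \<Rightarrow> nat) set" where
  "M_set n w = {m_elem n w i x | i x. i \<in> {1..n} \<and> x \<in> {1..lehmer n w i}}"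

locale distributive_lattice = lattice +
  assumes meet_join_distrib:
    "\<lbrakk>x \<in> carrier L; y \<in> carrier L; z \<in> carrier L\<rbrakk>
       \<Longrightarrow> x \<sqinter> (y \<squnion> z) = (x \<sqinter> y) \<squnion> (x \<sqinter> z)"

definition distributive_lattice_iso :: "('a, 'c) gorder_scheme \<Rightarrow> ('b, 'd) gorder_scheme \<Rightarrow> bool"
  where "distributive_lattice_iso L K \<longleftrightarrow> distributive_lattice L \<and> distributive_lattice K \<and>
    (\<exists>f. bij_betw f (carrier L) (carrier K) \<and> join_pres L K f \<and> meet_pres L K f)"

definition join_irreducibles :: "('a, 'b) gorder_scheme \<Rightarrow> 'a set" where
  "join_irreducibles L = {z \<in> carrier L. z \<noteq> \<bottom>\<^bsub>L\<^esub> \<and>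
     (\<forall>x \<in> carrier L. \<forall>y \<in> carrier L. z = x \<squnion>\<^bsub>L\<^esub> y \<longrightarrow> x = z \<or> y = z)}"

definition order_ideals :: "('a, 'b) gorder_scheme \<Rightarrow> 'a set set" where
  "order_ideals P = {I. I \<subseteq> carrier P \<and>
     (\<forall>x \<in> I. \<forall>y \<in> carrier P. y \<sqsubseteq>\<^bsub>P\<^esub> x \<longrightarrow> y \<in> I)}"

definition ideal_lattice :: "('a, 'b) gorder_scheme \<Rightarrow> 'a set gorder" where
  "ideal_lattice P = \<lparr>carrier = order_ideals P, eq = (=), le = (\<subseteq>)\<rparr>"

end

theory Submission
  imports Defs
begin

text \<open>
  The codes of the permutations below \<open>w\<close> are exactly the vectors \<open>x\<close> with
  \<open>x\<^sub>i \<le> x\<^sub>j + c\<^sub>i\<^sub>j(w)\<close> for all non-inversions \<open>(i, j)\<close> of \<open>w\<close>. That codes satisfy these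
  constraints is a count of inversions; conversely, a solution \<open>x\<close> other than the code of \<open>w\<close>
  still satisfies the constraints of some permutation covered by \<open>w\<close>, and one descends.
  A system of difference constraints is closed under coordinatewise maximum and minimum, and
  by the triangle inequality for \<open>c\<^sub>i\<^sub>j(w)\<close> the vector \<open>m\<^sub>i\<^sub>,\<^sub>x\<close> is its least solution with \<open>i\<close>-th
  coordinate at least \<open>x\<close>. Everything else follows from this minimality.
\<close>

section \<open>Inversions and the extended Lehmer code\<close>

lemma lehmer_eq_lehmer_ext: "lehmer n w i = lehmer_ext n w i (Suc n)"
proof -
  have "{k. (i, k) \<in> Inv n w} = {k. k < Suc n \<and> (i, k) \<in> Inv n w}"
    by (auto simp: Inv_def)
  then show ?thesis
    by (simp add: lehmer_def lehmer_ext_def)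
qed

lemma lehmer_outside: "i \<notin> {1..n} \<Longrightarrow> lehmer n w i = 0"
  by (auto simp: lehmer_def Inv_def)

lemma lehmer_ext_self [simp]: "lehmer_ext n w i i = 0"
  by (auto simp: lehmer_ext_def Inv_def)

lemma finite_Inv: "finite (Inv n w)"
  by (rule finite_subset[of _ "{1..n} \<times> {1..n}"]) (auto simp: Inv_def)

lemma finite_Inv_section: "finite {k. (i, k) \<in> Inv n w}"
  by (rule finite_subset[of _ "{1..n}"]) (auto simp: Inv_def)

lemma permutes_le_iff:
  fixes w :: "nat \<Rightarrow> nat"
  assumes "w permutes {1..n}"
  shows "w i \<le> n \<longleftrightarrow> i \<le> n" "0 < w i \<longleftrightarrow> 0 < i"
proof -
  have "w i \<in> {1..n} \<longleftrightarrow> i \<in> {1..n}"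
    by (rule permutes_in_image[OF assms])
  moreover have "w i = i" if "i \<notin> {1..n}"
    using permutes_not_in[OF assms that] .
  ultimately show "w i \<le> n \<longleftrightarrow> i \<le> n" "0 < w i \<longleftrightarrow> 0 < i"
    by (cases "i \<in> {1..n}"; auto)+
qed

text \<open>In column \<open>Suc n\<close> the value is \<open>Suc n\<close>, above all values of
  \<open>w\<close> on \<open>{1..n}\<close>, while \<open>Inv\<close> has no such column. This last
  column can therefore be treated like the others.\<close>

lemma nonInv_iff:
  assumes "w permutes {1..n}"
  shows "(i, j) \<in> nonInv n w \<longleftrightarrow>
    i \<in> {1..n} \<and> j \<in> {1..Suc n} \<and> i \<le> j \<and> (i, j) \<notin> Inv n w"
proof (cases "j = Suc n")
  case True
  then have "w j = Suc n"
    using permutes_not_in[OF assms, of j] by simp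
  then show ?thesis
    using True permutes_le_iff(1)[OF assms, of i] by (auto simp: nonInv_def Inv_def)
next
  case False
  then show ?thesis
    by (auto simp: nonInv_def Inv_def le_less)
qed

lemma nonInv_trans: "(i, j) \<in> nonInv n w \<Longrightarrow> (j, k) \<in> nonInv n w \<Longrightarrow> (i, k) \<in> nonInv n w"
  by (auto simp: nonInv_def)

text \<open>An inversion \<open>(i, l)\<close> with \<open>l\<close> not before \<open>j\<close>
  satisfies \<open>w l < w i \<le> w j\<close>, so it is passed on to \<open>j\<close>; the
  remaining ones are counted before \<open>j\<close>.\<close>

lemma lehmer_ext_triangle:
  assumes "(i, j) \<in> nonInv n w" "(j, k) \<in> nonInv n w"
  shows "lehmer_ext n w i k \<le> lehmer_ext n w i j + lehmer_ext n w j k"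
proof -
  have "(j, l) \<in> Inv n w" if "(i, l) \<in> Inv n w" "\<not> l < j" for l
  proof -
    have "l \<noteq> j"
      using that assms(1) by (auto simp: nonInv_def Inv_def)
    then show ?thesis
      using that assms(1) by (auto simp: nonInv_def Inv_def)
  qed
  then have "{l. l < k \<and> (i, l) \<in> Inv n w} \<subseteq>
      {l. l < j \<and> (i, l) \<in> Inv n w} \<union> {l. l < k \<and> (j, l) \<in> Inv n w}"
    by blast
  then have "lehmer_ext n w i k \<le>
      card ({l. l < j \<and> (i, l) \<in> Inv n w} \<union> {l. l < k \<and> (j, l) \<in> Inv n w})"
    unfolding lehmer_ext_def by (intro card_mono) auto
  also have "\<dots> \<le> lehmer_ext n w i j + lehmer_ext n w j k"
    unfolding lehmer_ext_def by (rule card_Un_le)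
  finally show ?thesis .
qed

section \<open>Positions holding consecutive values\<close>

lemma adjacent_values_strict:
  assumes "w permutes {1..n}" "w i = Suc (w j)" "l \<noteq> i" "l \<noteq> j"
  shows "w l < w i \<longleftrightarrow> w l < w j"
proof -
  have "w l \<noteq> w i" "w l \<noteq> w j"
    using assms(3,4) permutes_inj[OF assms(1)] by (auto dest: injD)
  then show ?thesis
    using assms(2) by auto
qed

text \<open>No value lies strictly between \<open>w j\<close> and \<open>w i\<close>, so beyond
  \<open>j\<close> both positions see the same smaller values. The extra one counts position
  \<open>j\<close> itself.\<close>

lemma lehmer_ext_adjacent_inversion:
  assumes w: "w permutes {1..n}" and inv: "(i, j) \<in> Inv n w"
    and val: "w i = Suc (w j)" and "j < k"
  shows "lehmer_ext n w i k = Suc (lehmer_ext n w i j + lehmer_ext n w j k)"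
proof -
  have "{l. l < k \<and> (i, l) \<in> Inv n w} = insert j
      ({l. l < j \<and> (i, l) \<in> Inv n w} \<union> {l. l < k \<and> (j, l) \<in> Inv n w})"
    (is "?A = insert j (?B \<union> ?C)")
  proof (rule Set.set_eqI)
    fix l
    show "l \<in> ?A \<longleftrightarrow> l \<in> insert j (?B \<union> ?C)"
      using inv \<open>j < k\<close> adjacent_values_strict[OF w val, of l]
      by (cases "l = i"; cases "l = j"; cases "l < j") (auto simp: Inv_def)
  qed
  moreover have "j \<notin> ?B \<union> ?C" "?B \<inter> ?C = {}"
    by (auto simp: Inv_def)
  ultimately show ?thesis
    by (simp add: lehmer_ext_def card_Un_disjoint)
qed

text \<open>The companion of the previous count when the smaller value comes first: beyond
  \<open>i\<close> both positions again have the same inversions, and position \<open>i\<close>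
  itself contributes none.\<close>

lemma lehmer_adjacent_noninversion:
  assumes w: "w permutes {1..n}" and pos: "j \<in> {1..n}" "i \<in> {1..n}" "j < i"
    and val: "w i = Suc (w j)"
  shows "lehmer n w j = lehmer_ext n w j i + lehmer n w i"
proof -
  have "{l. (j, l) \<in> Inv n w} =
      {l. l < i \<and> (j, l) \<in> Inv n w} \<union> {l. (i, l) \<in> Inv n w}" (is "?A = ?B \<union> ?C")
  proof (rule Set.set_eqI)
    fix l
    show "l \<in> ?A \<longleftrightarrow> l \<in> ?B \<union> ?C"
      using pos val adjacent_values_strict[OF w val, of l]
      by (cases "l = i"; cases "l = j"; cases "l < i") (auto simp: Inv_def)
  qed
  moreover have "?B \<inter> ?C = {}"
    by (auto simp: Inv_def)
  ultimately show ?thesis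
    by (simp add: lehmer_ext_def lehmer_def card_Un_disjoint finite_Inv_section)
qed

text \<open>Exchanging two consecutive values alters the relative order of the two positions holding
  them and of no other pair.\<close>

lemma Inv_transpose_values:
  assumes w: "w permutes {1..n}" and inv: "(i, j) \<in> Inv n w" and val: "w i = Suc (w j)"
  shows "Inv n (Transposition.transpose (w j) (Suc (w j)) \<circ> w) = Inv n w - {(i, j)}"
proof -
  let ?v = "Transposition.transpose (w j) (Suc (w j)) \<circ> w"
  have vi: "?v i = w j" and vj: "?v j = w i"
    using val by simp_all
  have v: "?v l = w l" if "l \<noteq> i" "l \<noteq> j" for l
  proof -
    have "w l \<noteq> w i" "w l \<noteq> w j"
      using that permutes_inj[OF w] by (auto dest: injD)
    then show ?thesis
      using val by (simp add: transpose_def)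
  qed
  have lt: "w l < w i \<longleftrightarrow> w l < w j" "w i < w l \<longleftrightarrow> w j < w l" if "l \<noteq> i" "l \<noteq> j" for l
  proof -
    have "w l \<noteq> w i"
      using that permutes_inj[OF w] by (auto dest: injD)
    then show "w l < w i \<longleftrightarrow> w l < w j" "w i < w l \<longleftrightarrow> w j < w l"
      using val adjacent_values_strict[OF w val that] by auto
  qed
  have ij: "i < j" "i \<noteq> j" "i \<in> {1..n}" "j \<in> {1..n}"
    using inv by (auto simp: Inv_def)
  have "(k, l) \<in> Inv n ?v \<longleftrightarrow> (k, l) \<in> Inv n w - {(i, j)}" for k l
  proof -
    consider "k = i" "l = j" | "k = i" "l = i" | "k = i" "l \<noteq> i" "l \<noteq> j"
      | "k = j" "l = i" | "k = j" "l = j" | "k = j" "l \<noteq> i" "l \<noteq> j"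
      | "k \<noteq> i" "k \<noteq> j" "l = i" | "k \<noteq> i" "k \<noteq> j" "l = j"
      | "k \<noteq> i" "k \<noteq> j" "l \<noteq> i" "l \<noteq> j"
      by blast
    then show ?thesis
      unfolding Inv_def
      by cases (use ij vi vj v lt val in \<open>simp_all del: comp_apply\<close>)
  qed
  then show ?thesis
    by (intro Set.set_eqI) (simp only: split_paired_all)
qed

section \<open>The codes below a permutation in left weak order\<close>

definition code_region :: "nat \<Rightarrow> (nat \<Rightarrow> nat) \<Rightarrow> (nat \<Rightarrow> nat) set" where
  "code_region n w = {x. (\<forall>i. i \<notin> {1..n} \<longrightarrow> x i = 0) \<and>
     (\<forall>i j. (i, j) \<in> nonInv n w \<longrightarrow> x i \<le> x j + lehmer_ext n w i j)}"

lemma code_region_outside: "x \<in> code_region n w \<Longrightarrow> i \<notin> {1..n} \<Longrightarrow> x i = 0"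
  by (simp add: code_region_def)

lemma code_regionD:
  "x \<in> code_region n w \<Longrightarrow> (i, j) \<in> nonInv n w \<Longrightarrow> x i \<le> x j + lehmer_ext n w i j"
  by (simp add: code_region_def)

text \<open>This is the constraint for the non-inversion \<open>(i, Suc n)\<close>: \<open>x\<close>
  vanishes at \<open>Suc n\<close>, and the extended code there is the full code.\<close>

lemma code_region_le_lehmer:
  assumes "w permutes {1..n}" "x \<in> code_region n w"
  shows "x i \<le> lehmer n w i"
proof (cases "i \<in> {1..n}")
  case True
  then have "(i, Suc n) \<in> nonInv n w"
    by (simp add: nonInv_iff[OF assms(1)] Inv_def)
  then show ?thesis
    using code_regionD[OF assms(2)] code_region_outside[OF assms(2), of "Suc n"]
    by (fastforce simp: lehmer_eq_lehmer_ext)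
next
  case False
  then show ?thesis
    using code_region_outside[OF assms(2)] by simp
qed

text \<open>A step exchanges the values \<open>a\<close> and \<open>Suc a\<close>, so it adds or
  removes exactly one inversion; the length condition rules out removal.\<close>

lemma left_weak_step_Inv_subset:
  assumes "left_weak_step n v w"
  shows "Inv n v \<subseteq> Inv n w"
proof -
  obtain a where v: "v permutes {1..n}" and w: "w permutes {1..n}"
    and a: "1 \<le> a" "a < n" and wv: "w = Transposition.transpose a (Suc a) \<circ> v"
    and len: "card (Inv n w) = Suc (card (Inv n v))"
    using assms by (auto simp: left_weak_step_def perm_length_def)
  obtain p q where p: "v p = a" and q: "v q = Suc a"
    using permutes_surj[OF v] by (metis surjD)
  have pq: "p \<in> {1..n}" "q \<in> {1..n}" "p \<noteq> q"
    using p q a permutes_in_image[OF v, of p] permutes_in_image[OF v, of q] by auto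
  show ?thesis
  proof (cases "q < p")
    case True
    then have "(q, p) \<in> Inv n v"
      using p q pq by (simp add: Inv_def)
    then have "Inv n w = Inv n v - {(q, p)}"
      using Inv_transpose_values[OF v] p q wv by force
    then have "card (Inv n w) \<le> card (Inv n v)"
      by (simp add: card_mono finite_Inv)
    then show ?thesis
      using len by simp
  next
    case False
    have "w p = Suc a" "w q = a"
      using p q wv by simp_all
    \<comment> \<open>The transposition is an involution, so \<open>v\<close> arises from
      \<open>w\<close> by removing the inversion \<open>(p, q)\<close>.\<close>
    moreover have "v = Transposition.transpose a (Suc a) \<circ> w"
      by (simp add: wv flip: comp_assoc)
    ultimately have "Inv n v = Inv n w - {(p, q)}"
      using Inv_transpose_values[OF w, of p q] pq False by (simp add: Inv_def)
    then show ?thesis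
      by blast
  qed
qed

lemma left_weak_le_Inv_subset:
  assumes "left_weak_le n v w"
  shows "Inv n v \<subseteq> Inv n w"
  using assms unfolding left_weak_le_def
  by induction (auto dest: left_weak_step_Inv_subset)

text \<open>The argument of the triangle inequality with two permutations: inversions of
  \<open>v\<close> before \<open>j\<close> are inversions of \<open>w\<close>, and those beyond
  \<open>j\<close> pass from \<open>i\<close> to \<open>j\<close> because \<open>(i, j)\<close> is
  also a non-inversion of \<open>v\<close>.\<close>

lemma lehmer_in_code_region:
  assumes w: "w permutes {1..n}" and v: "v permutes {1..n}" and sub: "Inv n v \<subseteq> Inv n w"
  shows "lehmer n v \<in> code_region n w"
proof -
  have "lehmer n v i \<le> lehmer n v j + lehmer_ext n w i j" if ij: "(i, j) \<in> nonInv n w" for i j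
  proof -
    have v_ij: "(i, j) \<in> nonInv n v"
      using ij sub by (auto simp: nonInv_iff[OF w] nonInv_iff[OF v])
    have "(j, k) \<in> Inv n v" if "(i, k) \<in> Inv n v" "\<not> k < j" for k
    proof -
      have "k \<noteq> j"
        using that v_ij by (auto simp: nonInv_def Inv_def)
      then show ?thesis
        using that v_ij by (auto simp: nonInv_def Inv_def)
    qed
    then have "{k. (i, k) \<in> Inv n v} \<subseteq>
        {k. k < j \<and> (i, k) \<in> Inv n w} \<union> {k. (j, k) \<in> Inv n v}"
      using sub by blast
    then have "lehmer n v i \<le>
        card ({k. k < j \<and> (i, k) \<in> Inv n w} \<union> {k. (j, k) \<in> Inv n v})"
      unfolding lehmer_def by (intro card_mono) (auto simp: finite_Inv_section)
    also have "\<dots> \<le> lehmer_ext n w i j + lehmer n v j"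
      unfolding lehmer_def lehmer_ext_def by (rule card_Un_le)
    finally show ?thesis
      by simp
  qed
  then show ?thesis
    by (simp add: code_region_def lehmer_outside)
qed

text \<open>If no descent qualifies, then climbing through the values \<open>1, \<dots>, n\<close> of \<open>w\<close>
  shows that \<open>x\<close> dominates the code of \<open>w\<close>.\<close>

lemma code_region_obtains_descent:
  assumes w: "w permutes {1..n}" and x: "x \<in> code_region n w" and "x \<noteq> lehmer n w"
  obtains i j where "(i, j) \<in> Inv n w" "w i = Suc (w j)" "x i \<le> x j + lehmer_ext n w i j"
proof (rule ccontr)
  assume "\<not> thesis"
  then have no: "x j + lehmer_ext n w i j < x i" if "(i, j) \<in> Inv n w" "w i = Suc (w j)" for i j
    using that \<open>\<And>i j. \<lbrakk>(i, j) \<in> Inv n w; w i = Suc (w j); x i \<le> x j + lehmer_ext n w i j\<rbrakk> \<Longrightarrow> thesis\<close>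
    by (meson not_le)
  have ge: "lehmer n w i \<le> x i" if "w i = a" for i a
    using that
  proof (induction a arbitrary: i)
    case 0
    then have "i \<notin> {1..n}"
      using permutes_le_iff(2)[OF w, of i] by auto
    then show ?case
      by (simp add: lehmer_outside)
  next
    case (Suc a)
    obtain j where j: "w j = a"
      using permutes_surj[OF w] by (metis surjD)
    have IH: "lehmer n w j \<le> x j"
      using Suc.IH[OF j] .
    show ?case
    proof (cases "i \<in> {1..n} \<and> j \<in> {1..n}")
      case True
      consider "i < j" | "j < i" | "i = j"
        by linarith
      then show ?thesis
      proof cases
        case 1
        have "(i, j) \<in> Inv n w"
          using 1 True Suc.prems j by (simp add: Inv_def)
        moreover have "lehmer n w i = Suc (lehmer_ext n w i j + lehmer n w j)"
          using lehmer_ext_adjacent_inversion[OF w calculation, of "Suc n"] Suc.prems j True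
          by (simp add: lehmer_eq_lehmer_ext)
        \<comment> \<open>The strict inequality in \<open>no\<close> supplies the extra one in the
          code of \<open>w\<close> at \<open>i\<close>.\<close>
        ultimately show ?thesis
          using no[of i j] IH Suc.prems j by simp
      next
        case 2
        \<comment> \<open>Here the lower bound at \<open>i\<close> comes from a constraint of the
          region, and the matching count for \<open>w\<close> is an equality.\<close>
        have "(j, i) \<in> nonInv n w"
          using 2 True Suc.prems j by (simp add: nonInv_def)
        then have "x j \<le> x i + lehmer_ext n w j i"
          by (rule code_regionD[OF x])
        moreover have "lehmer n w j = lehmer_ext n w j i + lehmer n w i"
          using lehmer_adjacent_noninversion[OF w] 2 True Suc.prems j by simp
        ultimately show ?thesis
          using IH by simp
      next
        case 3
        then show ?thesis
          using Suc.prems j by simp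
      qed
    next
      \<comment> \<open>If \<open>i\<close> is in range then \<open>j\<close> is \<open>0\<close>,
        so \<open>i\<close> holds the smallest value \<open>1\<close> and starts no
        inversion.\<close>
      case False
      show ?thesis
      proof (cases "i \<in> {1..n}")
        case True
        then have "\<not> n < j"
          using Suc.prems j permutes_le_iff(1)[OF w, of i] permutes_le_iff(1)[OF w, of j] by auto
        then have "j = 0"
          using False True by auto
        then have "w i = 1"
          using Suc.prems j permutes_le_iff(2)[OF w, of j] by simp
        then have "(i, k) \<notin> Inv n w" for k
          using permutes_le_iff(2)[OF w, of k] by (auto simp: Inv_def)
        then show ?thesis
          by (simp add: lehmer_def)
      qed (simp add: lehmer_outside)
    qed
  qed
  have "x = lehmer n w"
    using ge code_region_le_lehmer[OF w x] by (auto intro!: ext antisym)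
  then show False
    using \<open>x \<noteq> lehmer n w\<close> by simp
qed

text \<open>Only the constraints for pairs \<open>(i, l)\<close> with \<open>j \<le> l\<close> can
  change. The one at \<open>l = j\<close> is the assumption \<open>le\<close>; for
  \<open>l > j\<close> the bound drops by one to the sum of the bounds for \<open>(i, j)\<close> and
  \<open>(j, l)\<close>, so chaining these two constraints suffices.\<close>

lemma code_region_step:
  assumes w: "w permutes {1..n}" and x: "x \<in> code_region n w"
    and inv: "(i, j) \<in> Inv n w" and val: "w i = Suc (w j)"
    and le: "x i \<le> x j + lehmer_ext n w i j"
    and v: "v permutes {1..n}" and Inv_v: "Inv n v = Inv n w - {(i, j)}"
  shows "x \<in> code_region n v"
proof -
  have ij: "i < j" "i \<in> {1..n}" "j \<in> {1..n}"
    using inv by (auto simp: Inv_def)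
  have "x k \<le> x l + lehmer_ext n v k l" if kl: "(k, l) \<in> nonInv n v" for k l
  proof (cases "k = i \<and> j \<le> l")
    case False
    then have "(k, l) \<in> nonInv n w"
      using kl by (auto simp: nonInv_iff[OF w] nonInv_iff[OF v] Inv_v)
    moreover have "{m. m < l \<and> (k, m) \<in> Inv n v} = {m. m < l \<and> (k, m) \<in> Inv n w}"
      using False by (auto simp: Inv_v)
    ultimately show ?thesis
      using code_regionD[OF x] by (simp add: lehmer_ext_def)
  next
    case True
    show ?thesis
    proof (cases "l = j")
      case True
      have "{m. m < j \<and> (i, m) \<in> Inv n v} = {m. m < j \<and> (i, m) \<in> Inv n w}"
        by (auto simp: Inv_v)
      then show ?thesis
        using le True \<open>k = i \<and> j \<le> l\<close> by (simp add: lehmer_ext_def)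
    next
      case False
      then have "j < l" "k = i"
        using True by auto
      have "(i, l) \<in> nonInv n w"
        using kl False \<open>k = i\<close> by (auto simp: nonInv_iff[OF w] nonInv_iff[OF v] Inv_v)
      then have "(j, l) \<in> nonInv n w"
        using \<open>j < l\<close> val ij by (auto simp: nonInv_def)
      then have "x j \<le> x l + lehmer_ext n w j l"
        by (rule code_regionD[OF x])
      moreover have "lehmer_ext n w i l = Suc (lehmer_ext n w i j + lehmer_ext n w j l)"
        by (rule lehmer_ext_adjacent_inversion[OF w inv val \<open>j < l\<close>])
      moreover have "lehmer_ext n w i l = Suc (lehmer_ext n v i l)"
      proof -
        have "{m. m < l \<and> (i, m) \<in> Inv n w} = insert j {m. m < l \<and> (i, m) \<in> Inv n v}"
          using inv \<open>j < l\<close> by (auto simp: Inv_v)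
        moreover have "j \<notin> {m. m < l \<and> (i, m) \<in> Inv n v}"
          by (simp add: Inv_v)
        ultimately show ?thesis
          by (simp add: lehmer_ext_def)
      qed
      ultimately show ?thesis
        using le \<open>k = i\<close> by simp
    qed
  qed
  then show ?thesis
    using code_region_outside[OF x] by (simp add: code_region_def)
qed

text \<open>Induction on length: unless \<open>x\<close> is already the code of \<open>w\<close>, a
  qualifying descent yields a shorter \<open>v\<close>, one step below \<open>w\<close>, whose
  region still contains \<open>x\<close>.\<close>

lemma code_region_subset:
  assumes "w permutes {1..n}" "x \<in> code_region n w"
  shows "x \<in> lehmer n ` Lambda n w"
  using assms
proof (induction "perm_length n w" arbitrary: w rule: less_induct)
  case less
  note w = less.prems(1) and x = less.prems(2)
  show ?case
  proof (cases "x = lehmer n w")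
    case True
    moreover have "w \<in> Lambda n w"
      using w by (simp add: Lambda_def left_weak_le_def)
    ultimately show ?thesis
      by blast
  next
    case False
    obtain i j where inv: "(i, j) \<in> Inv n w" and val: "w i = Suc (w j)"
      and le: "x i \<le> x j + lehmer_ext n w i j"
      using code_region_obtains_descent[OF w x False] .
    define s where "s = Transposition.transpose (w j) (Suc (w j))"
    define v where "v = s \<circ> w"
    have ij: "i \<in> {1..n}" "j \<in> {1..n}"
      using inv by (auto simp: Inv_def)
    then have wj: "w j \<in> {1..n}" "Suc (w j) \<in> {1..n}"
      using permutes_in_image[OF w] val by metis+
    have v: "v permutes {1..n}"
      unfolding v_def s_def by (intro permutes_compose[OF w] permutes_swap_id wj)
    have Inv_v: "Inv n v = Inv n w - {(i, j)}"
      unfolding v_def s_def by (rule Inv_transpose_values[OF w inv val])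
    have len: "perm_length n w = Suc (perm_length n v)"
      using card_Suc_Diff1[OF finite_Inv inv] by (simp add: perm_length_def Inv_v)
    have "w = s \<circ> v"
      by (simp add: v_def s_def flip: comp_assoc)
    then have "left_weak_step n v w"
      using v w len wj unfolding left_weak_step_def s_def by auto
    moreover obtain u where "u \<in> Lambda n v" "x = lehmer n u"
      using less.hyps[OF _ v code_region_step[OF w x inv val le v Inv_v]] len by auto
    ultimately have "u \<in> Lambda n w"
      by (auto simp: Lambda_def left_weak_le_def)
    then show ?thesis
      using \<open>x = lehmer n u\<close> by blast
  qed
qed

lemma codes_eq_code_region:
  assumes "w permutes {1..n}"
  shows "lehmer n ` Lambda n w = code_region n w"
proof
  show "lehmer n ` Lambda n w \<subseteq> code_region n w"
    using lehmer_in_code_region[OF assms] left_weak_le_Inv_subset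
    unfolding Lambda_def by blast
  show "code_region n w \<subseteq> lehmer n ` Lambda n w"
    using code_region_subset[OF assms] by blast
qed

section \<open>The elements \<open>m\<close> as least codes with a prescribed coordinate\<close>

lemma m_elem_self: "i \<in> {1..n} \<Longrightarrow> m_elem n w i x i = x"
  by (simp add: m_elem_def Inv_def)

text \<open>A nonzero coordinate at \<open>j\<close> makes \<open>(i, j)\<close> a non-inversion;
  composing it with \<open>(j, k)\<close> reduces the constraint to the triangle inequality. The
  bound on \<open>x\<close> serves the column \<open>k = Suc n\<close>, where the vector
  vanishes.\<close>

lemma m_elem_in_code_region:
  assumes w: "w permutes {1..n}" and "i \<in> {1..n}" "x \<le> lehmer n w i"
  shows "m_elem n w i x \<in> code_region n w"
proof -
  have "m_elem n w i x j \<le> m_elem n w i x k + lehmer_ext n w j k"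
    if jk: "(j, k) \<in> nonInv n w" for j k
  proof (cases "m_elem n w i x j = 0")
    case False
    then have ij: "(i, j) \<in> nonInv n w"
      using assms(2) by (auto simp: m_elem_def nonInv_iff[OF w] split: if_splits)
    then have ik: "(i, k) \<in> nonInv n w"
      using jk by (rule nonInv_trans)
    have "m_elem n w i x j = x - lehmer_ext n w i j"
      using ij jk False by (auto simp: m_elem_def split: if_splits)
    moreover have "x \<le> m_elem n w i x k + lehmer_ext n w i k"
    proof (cases "k = Suc n")
      case True
      then show ?thesis
        using assms(3) by (simp add: lehmer_eq_lehmer_ext)
    next
      case False
      then show ?thesis
        using ik by (auto simp: m_elem_def nonInv_iff[OF w])
    qed
    ultimately show ?thesis
      using lehmer_ext_triangle[OF ij jk] by simp
  qed simp
  moreover have "m_elem n w i x j = 0" if "j \<notin> {1..n}" for j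
    using that by (simp add: m_elem_def)
  ultimately show ?thesis
    by (simp add: code_region_def)
qed

text \<open>The key minimality property, reducing a comparison of vectors to one coordinate: the
  constraints of \<open>z\<close> at the non-inversions \<open>(i, j)\<close> force
  \<open>x - lehmer_ext n w i j \<le> z j\<close>, and elsewhere the left vector is zero.\<close>

lemma m_elem_le_iff:
  assumes w: "w permutes {1..n}" and i: "i \<in> {1..n}" and z: "z \<in> code_region n w"
  shows "le_S n (m_elem n w i x) z \<longleftrightarrow> x \<le> z i"
proof
  assume "le_S n (m_elem n w i x) z"
  then have "m_elem n w i x i \<le> z i"
    using i by (simp add: le_S_def)
  then show "x \<le> z i"
    by (simp add: m_elem_self[OF i])
next
  assume le: "x \<le> z i"
  have "m_elem n w i x j \<le> z j" if j: "j \<in> {1..n}" for j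
  proof (cases "(i, j) \<in> nonInv n w")
    case True
    then have "x \<le> z j + lehmer_ext n w i j"
      using le code_regionD[OF z] by (blast intro: order_trans)
    then have "x - lehmer_ext n w i j \<le> z j"
      by simp
    then show ?thesis
      by (simp add: m_elem_def)
  next
    case False
    then show ?thesis
      using i j by (auto simp: m_elem_def nonInv_iff[OF w])
  qed
  then show "le_S n (m_elem n w i x) z"
    by (simp add: le_S_def)
qed

lemma finite_M_set: "finite (M_set n w)"
proof -
  have "M_set n w = (\<Union>i\<in>{1..n}. m_elem n w i ` {1..lehmer n w i})"
    unfolding M_set_def by blast
  then show ?thesis
    by simp
qed

lemma M_set_subset_code_region:
  assumes "w permutes {1..n}"
  shows "M_set n w \<subseteq> code_region n w"
proof
  fix z
  assume "z \<in> M_set n w"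
  then obtain i x where "i \<in> {1..n}" "x \<in> {1..lehmer n w i}" "z = m_elem n w i x"
    by (auto simp: M_set_def)
  then show "z \<in> code_region n w"
    using m_elem_in_code_region[OF assms] by simp
qed

lemma m_elem_in_M_set:
  assumes "w permutes {1..n}" "z \<in> code_region n w" "z i \<noteq> 0"
  shows "m_elem n w i (z i) \<in> M_set n w"
proof -
  have "i \<in> {1..n}"
    using assms(3) code_region_outside[OF assms(2), of i] by argo
  moreover have "z i \<in> {1..lehmer n w i}"
    using code_region_le_lehmer[OF assms(1,2), of i] assms(3) by simp
  ultimately show ?thesis
    unfolding M_set_def by blast
qed

section \<open>Lattice structure\<close>

lemma (in partial_order) join_eqI:
  assumes "least L s (Upper L {x, y})"
  shows "x \<squnion> y = s"
  unfolding join_def sup_def using assms by (blast intro: some_equality least_unique)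

lemma (in partial_order) meet_eqI:
  assumes "greatest L s (Lower L {x, y})"
  shows "x \<sqinter> y = s"
  unfolding meet_def inf_def using assms by (blast intro: some_equality greatest_unique)

text \<open>Explicit operations \<open>J\<close> and \<open>M\<close> allow the distributive law to
  be checked on them instead of on joins and meets defined by choice.\<close>

lemma (in partial_order) distributive_latticeI:
  assumes J: "\<And>x y. \<lbrakk>x \<in> carrier L; y \<in> carrier L\<rbrakk> \<Longrightarrow> least L (J x y) (Upper L {x, y})"
    and M: "\<And>x y. \<lbrakk>x \<in> carrier L; y \<in> carrier L\<rbrakk> \<Longrightarrow> greatest L (M x y) (Lower L {x, y})"
    and dist: "\<And>x y z. \<lbrakk>x \<in> carrier L; y \<in> carrier L; z \<in> carrier L\<rbrakk>
      \<Longrightarrow> M x (J y z) = J (M x y) (M x z)"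
  shows "distributive_lattice L"
proof -
  interpret lattice L
    by unfold_locales (use J M in blast)+
  have join: "x \<squnion> y = J x y" if "x \<in> carrier L" "y \<in> carrier L" for x y
    using join_eqI[OF J[OF that]] .
  have meet: "x \<sqinter> y = M x y" if "x \<in> carrier L" "y \<in> carrier L" for x y
    using meet_eqI[OF M[OF that]] .
  have "x \<sqinter> (y \<squnion> z) = (x \<sqinter> y) \<squnion> (x \<sqinter> z)"
    if "x \<in> carrier L" "y \<in> carrier L" "z \<in> carrier L" for x y z
  proof -
    have "J y z \<in> carrier L" "M x y \<in> carrier L" "M x z \<in> carrier L"
      using J M that by (blast dest: least_closed greatest_closed)+
    then show ?thesis
      using that dist by (simp add: join meet)
  qed
  then show ?thesis
    by unfold_locales
qed

section \<open>Order ideals under union and intersection\<close>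

lemma order_ideals_Un: "I \<in> order_ideals P \<Longrightarrow> K \<in> order_ideals P \<Longrightarrow> I \<union> K \<in> order_ideals P"
  by (auto simp: order_ideals_def)

lemma order_ideals_Int: "I \<in> order_ideals P \<Longrightarrow> K \<in> order_ideals P \<Longrightarrow> I \<inter> K \<in> order_ideals P"
  by (auto simp: order_ideals_def)

lemma carrier_ideal_lattice [simp]: "carrier (ideal_lattice P) = order_ideals P"
  by (simp add: ideal_lattice_def)

lemma carrier_order_S [simp]: "carrier (order_S n A) = A"
  by (simp add: order_S_def)

lemma partial_order_ideal_lattice: "partial_order (ideal_lattice P)"
  by unfold_locales (auto simp: ideal_lattice_def)

lemma ideal_lattice_least:
  "I \<in> order_ideals P \<Longrightarrow> K \<in> order_ideals P \<Longrightarrow>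
    least (ideal_lattice P) (I \<union> K) (Upper (ideal_lattice P) {I, K})"
  using order_ideals_Un[of I P K] by (auto simp: least_def Upper_def ideal_lattice_def)

lemma ideal_lattice_greatest:
  "I \<in> order_ideals P \<Longrightarrow> K \<in> order_ideals P \<Longrightarrow>
    greatest (ideal_lattice P) (I \<inter> K) (Lower (ideal_lattice P) {I, K})"
  using order_ideals_Int[of I P K] by (auto simp: greatest_def Lower_def ideal_lattice_def)

lemma distributive_lattice_ideal_lattice: "distributive_lattice (ideal_lattice P)"
proof -
  interpret partial_order "ideal_lattice P"
    by (rule partial_order_ideal_lattice)
  show ?thesis
    by (rule distributive_latticeI[where J = "(\<union>)" and M = "(\<inter>)"])
      (auto simp: ideal_lattice_least ideal_lattice_greatest carrier_ideal_lattice)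
qed

section \<open>Codes under coordinatewise maximum and minimum\<close>

abbreviation pmax :: "(nat \<Rightarrow> nat) \<Rightarrow> (nat \<Rightarrow> nat) \<Rightarrow> nat \<Rightarrow> nat" where
  "pmax x y \<equiv> (\<lambda>i. max (x i) (y i))"

abbreviation pmin :: "(nat \<Rightarrow> nat) \<Rightarrow> (nat \<Rightarrow> nat) \<Rightarrow> nat \<Rightarrow> nat" where
  "pmin x y \<equiv> (\<lambda>i. min (x i) (y i))"

text \<open>The maximum at \<open>i\<close> is attained by one of the two vectors, and the
  constraint of that vector bounds it. For minima, use the vector attaining the minimum at
  \<open>j\<close>.\<close>

lemma code_region_pmax:
  "x \<in> code_region n w \<Longrightarrow> y \<in> code_region n w \<Longrightarrow> pmax x y \<in> code_region n w"
  by (fastforce simp: code_region_def max_def)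

lemma code_region_pmin:
  "x \<in> code_region n w \<Longrightarrow> y \<in> code_region n w \<Longrightarrow> pmin x y \<in> code_region n w"
  by (fastforce simp: code_region_def min_def)

lemma zero_in_code_region: "(\<lambda>_. 0) \<in> code_region n w"
  by (simp add: code_region_def)

text \<open>\<open>le_S\<close> compares only coordinates in \<open>{1..n}\<close>; outside, both
  vectors vanish.\<close>

lemma code_region_antisym:
  assumes "x \<in> code_region n w" "y \<in> code_region n w" "le_S n x y" "le_S n y x"
  shows "x = y"
proof
  fix i
  show "x i = y i"
    using assms code_region_outside[OF assms(1), of i] code_region_outside[OF assms(2), of i]
    by (cases "i \<in> {1..n}") (auto simp: le_S_def intro: antisym)
qed

lemma partial_order_code_region: "partial_order (order_S n (code_region n w))"
  by unfold_locales
    (auto simp: order_S_def le_S_def intro: code_region_antisym[unfolded le_S_def] order_trans)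

lemma code_region_least:
  "x \<in> code_region n w \<Longrightarrow> y \<in> code_region n w \<Longrightarrow>
    least (order_S n (code_region n w)) (pmax x y) (Upper (order_S n (code_region n w)) {x, y})"
  using code_region_pmax[of x n w y] by (auto simp: least_def Upper_def order_S_def le_S_def)

lemma code_region_greatest:
  "x \<in> code_region n w \<Longrightarrow> y \<in> code_region n w \<Longrightarrow>
    greatest (order_S n (code_region n w)) (pmin x y) (Lower (order_S n (code_region n w)) {x, y})"
  using code_region_pmin[of x n w y] by (auto simp: greatest_def Lower_def order_S_def le_S_def)

lemmas join_code_region = partial_order.join_eqI[OF partial_order_code_region code_region_least]
lemmas meet_code_region = partial_order.meet_eqI[OF partial_order_code_region code_region_greatest]
lemmas join_ideal_lattice = partial_order.join_eqI[OF partial_order_ideal_lattice ideal_lattice_least]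
lemmas meet_ideal_lattice = partial_order.meet_eqI[OF partial_order_ideal_lattice ideal_lattice_greatest]

lemma distributive_lattice_code_region: "distributive_lattice (order_S n (code_region n w))"
proof -
  interpret partial_order "order_S n (code_region n w)"
    by (rule partial_order_code_region)
  show ?thesis
    by (rule distributive_latticeI[where J = pmax and M = pmin])
      (auto simp: code_region_least code_region_greatest carrier_order_S min_max_distrib2)
qed

lemma bottom_code_region: "\<bottom>\<^bsub>order_S n (code_region n w)\<^esub> = (\<lambda>_. 0)"
proof -
  interpret partial_order "order_S n (code_region n w)"
    by (rule partial_order_code_region)
  have "least (order_S n (code_region n w)) (\<lambda>_. 0) (code_region n w)"
    using zero_in_code_region by (auto simp: least_def order_S_def le_S_def)
  then show ?thesis
    unfolding bottom_def by (auto simp: carrier_order_S intro: some_equality least_unique)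
qed

section \<open>Join-irreducible codes\<close>

lemma join_irreducibles_code_region:
  assumes w: "w permutes {1..n}"
  shows "join_irreducibles (order_S n (code_region n w)) = M_set n w"
proof
  show "M_set n w \<subseteq> join_irreducibles (order_S n (code_region n w))"
  proof
    fix z
    assume "z \<in> M_set n w"
    then obtain i k where i: "i \<in> {1..n}" and k: "k \<in> {1..lehmer n w i}"
      and z: "z = m_elem n w i k"
      by (auto simp: M_set_def)
    have zi: "z i = k" and zC: "z \<in> code_region n w"
      using m_elem_self[OF i] m_elem_in_code_region[OF w i] k z by auto
    have "x = z \<or> y = z"
      if x: "x \<in> code_region n w" and y: "y \<in> code_region n w" and xy: "z = pmax x y" for x y
    proof -
      \<comment> \<open>A maximum reaches \<open>k\<close> at \<open>i\<close> only if one argument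
        does, and by minimality that argument dominates \<open>z\<close>.\<close>
      have "k \<le> x i \<or> k \<le> y i"
        using zi fun_cong[OF xy, of i] by linarith
      then have "le_S n z x \<or> le_S n z y"
        using m_elem_le_iff[OF w i x] m_elem_le_iff[OF w i y] z by blast
      moreover have "le_S n x z" "le_S n y z"
        by (simp_all add: xy le_S_def)
      ultimately show ?thesis
        using code_region_antisym x y zC by blast
    qed
    moreover have "z \<noteq> (\<lambda>_. 0)"
      using zi k by auto
    ultimately show "z \<in> join_irreducibles (order_S n (code_region n w))"
      using zC by (simp add: join_irreducibles_def bottom_code_region carrier_order_S join_code_region)
  qed
next
  show "join_irreducibles (order_S n (code_region n w)) \<subseteq> M_set n w"
  proof
    fix z
    assume "z \<in> join_irreducibles (order_S n (code_region n w))"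
    then have z: "z \<in> code_region n w" and nz: "z \<noteq> (\<lambda>_. 0)"
      and irr: "\<And>x y. \<lbrakk>x \<in> code_region n w; y \<in> code_region n w; z = pmax x y\<rbrakk> \<Longrightarrow> x = z \<or> y = z"
      by (auto simp: join_irreducibles_def bottom_code_region carrier_order_S join_code_region)
    text \<open>Take the first \<open>k\<close> for which the generators \<open>m_elem n w i (z i)\<close> with \<open>i \<le> k\<close>
      join to \<open>z\<close>; irreducibility forces \<open>z\<close> to be the last of them.\<close>
    define g where "g = (\<lambda>k. rec_nat (\<lambda>_. 0) (\<lambda>i p. pmax p (m_elem n w (Suc i) (z (Suc i)))) k)"
    have g0: "g 0 = (\<lambda>_. 0)"
      and gS: "g (Suc k) = pmax (g k) (m_elem n w (Suc k) (z (Suc k)))" for k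
      by (simp_all add: g_def)
    have m: "m_elem n w i (z i) \<in> code_region n w" "le_S n (m_elem n w i (z i)) z"
      if "i \<in> {1..n}" for i
      using m_elem_in_code_region[OF w that code_region_le_lehmer[OF w z]]
        m_elem_le_iff[OF w that z] by auto
    have g: "g k \<in> code_region n w \<and> le_S n (g k) z \<and> (\<forall>i\<in>{1..k}. z i \<le> g k i)"
      if "k \<le> n" for k
      using that
    proof (induction k)
      case 0
      then show ?case
        by (simp add: g0 zero_in_code_region le_S_def)
    next
      case (Suc k)
      then have k: "Suc k \<in> {1..n}"
        by simp
      have "z i \<le> g (Suc k) i" if "i \<in> {1..Suc k}" for i
      proof (cases "i = Suc k")
        case True
        then show ?thesis
          using m_elem_self[OF k, of w "z (Suc k)"] by (simp add: gS)
      next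
        case False
        then have "z i \<le> g k i"
          using that Suc by simp
        then show ?thesis
          by (simp add: gS le_max_iff_disj)
      qed
      then show ?case
        using Suc m[OF k] code_region_pmax by (auto simp: gS le_S_def)
    qed
    have "g n = z"
      using g[of n] by (intro code_region_antisym[OF _ z]) (auto simp: le_S_def)
    moreover have "z \<in> M_set n w" if "k \<le> n" "g k = z" for k
      using that
    proof (induction k)
      case 0
      then show ?case
        using nz g0 by simp
    next
      case (Suc k)
      then have k: "Suc k \<in> {1..n}"
        by simp
      consider "g k = z" | "m_elem n w (Suc k) (z (Suc k)) = z"
        using irr[of "g k" "m_elem n w (Suc k) (z (Suc k))"] g[of k] m[OF k] Suc.prems
        by (auto simp: gS)
      then show ?case
      proof cases
        case 1
        then show ?thesis
          using Suc by simp
      next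
        case 2
        \<comment> \<open>\<open>M_set\<close> only has positive parameters, so the zero vector
          produced by a zero coordinate must be excluded.\<close>
        have "z (Suc k) \<noteq> 0"
        proof
          assume "z (Suc k) = 0"
          then have "m_elem n w (Suc k) (z (Suc k)) = (\<lambda>_. 0)"
            by (auto simp: m_elem_def)
          then show False
            using 2 nz by simp
        qed
        then show ?thesis
          using m_elem_in_M_set[OF w z, of "Suc k"] 2 by simp
      qed
    qed
    ultimately show "z \<in> M_set n w"
      by blast
  qed
qed

section \<open>The correspondence between order ideals and codes\<close>

definition ideal_code :: "(nat \<Rightarrow> nat) set \<Rightarrow> nat \<Rightarrow> nat" where
  "ideal_code I = (\<lambda>j. Max (insert 0 ((\<lambda>p. p j) ` I)))"

text \<open>The \<open>0\<close> inserted in \<open>ideal_code\<close> sends the empty ideal to the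
  zero vector; a nonzero \<open>k\<close> can only be reached by a member of
  \<open>I\<close>.\<close>

lemma le_ideal_code_iff:
  assumes "finite I" "k \<noteq> 0"
  shows "k \<le> ideal_code I j \<longleftrightarrow> (\<exists>p\<in>I. k \<le> p j)"
  using assms by (auto simp: ideal_code_def Max_ge_iff)

lemma ideal_code_in_code_region:
  assumes "finite I" "I \<subseteq> code_region n w"
  shows "ideal_code I \<in> code_region n w"
proof -
  have "ideal_code I i \<le> ideal_code I j + lehmer_ext n w i j" if ij: "(i, j) \<in> nonInv n w" for i j
  proof (cases "ideal_code I i = 0")
    case False
    then obtain p where p: "p \<in> I" "ideal_code I i \<le> p i"
      using le_ideal_code_iff[OF assms(1), of "ideal_code I i" i] by auto
    then have "p i \<le> p j + lehmer_ext n w i j"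
      using assms(2) code_regionD[OF _ ij] by blast
    moreover have "p j \<le> ideal_code I j"
      using p(1) assms(1) by (simp add: ideal_code_def)
    ultimately show ?thesis
      using p(2) by linarith
  qed simp
  moreover have "ideal_code I i = 0" if "i \<notin> {1..n}" for i
  proof (rule ccontr)
    assume "ideal_code I i \<noteq> 0"
    then obtain p where "p \<in> I" "ideal_code I i \<le> p i"
      using le_ideal_code_iff[OF assms(1), of "ideal_code I i" i] by auto
    then show False
      using code_region_outside[of p n w i] that assms(2) \<open>ideal_code I i \<noteq> 0\<close> by auto
  qed
  ultimately show ?thesis
    by (simp add: code_region_def)
qed

lemma ideal_code_Un:
  assumes "finite I" "finite K"
  shows "ideal_code (I \<union> K) = pmax (ideal_code I) (ideal_code K)"
proof
  fix j
  have "insert 0 ((\<lambda>p. p j) ` (I \<union> K)) = insert 0 ((\<lambda>p. p j) ` I) \<union> insert 0 ((\<lambda>p. p j) ` K)"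
    by auto
  then show "ideal_code (I \<union> K) j = max (ideal_code I j) (ideal_code K j)"
    unfolding ideal_code_def using assms by (simp only:) (rule Max_Un; simp)
qed

text \<open>Birkhoff's map from lattice elements to ideals of join-irreducibles, the inverse of
  \<open>ideal_code\<close>.\<close>

definition principal_ideal :: "nat \<Rightarrow> (nat \<Rightarrow> nat) \<Rightarrow> (nat \<Rightarrow> nat) \<Rightarrow> (nat \<Rightarrow> nat) set" where
  "principal_ideal n w z = {p \<in> M_set n w. le_S n p z}"

text \<open>If a generator with parameters \<open>i\<close> and \<open>k\<close> lies below the join
  of \<open>I\<close>, some \<open>q\<close> in \<open>I\<close> has \<open>i\<close>-th coordinate
  at least \<open>k\<close>. By minimality the generator is below \<open>q\<close>, hence in
  \<open>I\<close>.\<close>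

lemma principal_ideal_code:
  assumes w: "w permutes {1..n}" and I: "I \<in> order_ideals (order_S n (M_set n w))"
  shows "principal_ideal n w (ideal_code I) = I"
proof -
  have sub: "I \<subseteq> M_set n w"
    and down: "\<And>p q. \<lbrakk>p \<in> I; q \<in> M_set n w; le_S n q p\<rbrakk> \<Longrightarrow> q \<in> I"
    using I by (auto simp: order_ideals_def order_S_def)
  have fin: "finite I"
    using sub finite_M_set by (rule finite_subset)
  have subC: "I \<subseteq> code_region n w"
    using sub M_set_subset_code_region[OF w] by blast
  have "p \<in> I" if p: "p \<in> M_set n w" "le_S n p (ideal_code I)" for p
  proof -
    obtain i k where i: "i \<in> {1..n}" and k: "k \<in> {1..lehmer n w i}" and pk: "p = m_elem n w i k"
      using p(1) by (auto simp: M_set_def)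
    have "k \<le> ideal_code I i"
      using p(2) pk m_elem_le_iff[OF w i ideal_code_in_code_region[OF fin subC]] by simp
    then obtain q where q: "q \<in> I" "k \<le> q i"
      using le_ideal_code_iff[OF fin] k by auto
    then have "le_S n p q"
      using pk m_elem_le_iff[OF w i] subC by blast
    then show ?thesis
      using down q(1) p(1) by blast
  qed
  moreover have "le_S n p (ideal_code I)" if "p \<in> I" for p
    using that fin by (simp add: le_S_def ideal_code_def)
  ultimately show ?thesis
    using sub by (auto simp: principal_ideal_def)
qed

text \<open>Each nonzero coordinate \<open>z i\<close> is attained by the generator
  \<open>m_elem n w i (z i)\<close>, which lies below \<open>z\<close>.\<close>

lemma ideal_code_principal:
  assumes w: "w permutes {1..n}" and z: "z \<in> code_region n w"
  shows "ideal_code (principal_ideal n w z) = z"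
proof -
  let ?I = "principal_ideal n w z"
  have fin: "finite ?I"
    using finite_M_set by (simp add: principal_ideal_def)
  have "?I \<subseteq> code_region n w"
    using M_set_subset_code_region[OF w] by (auto simp: principal_ideal_def)
  then have C: "ideal_code ?I \<in> code_region n w"
    by (rule ideal_code_in_code_region[OF fin])
  have "ideal_code ?I i \<le> z i" if "i \<in> {1..n}" for i
    using fin that by (auto simp: ideal_code_def principal_ideal_def le_S_def)
  moreover have "z i \<le> ideal_code ?I i" if i: "i \<in> {1..n}" for i
  proof (cases "z i = 0")
    case False
    have "m_elem n w i (z i) \<in> ?I"
      using m_elem_in_M_set[OF w z False] m_elem_le_iff[OF w i z] by (simp add: principal_ideal_def)
    then show ?thesis
      using le_ideal_code_iff[OF fin False] m_elem_self[OF i] by (metis order_refl)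
  qed simp
  ultimately show ?thesis
    by (intro code_region_antisym[OF C z]) (auto simp: le_S_def)
qed

lemma principal_ideal_in_order_ideals:
  "principal_ideal n w z \<in> order_ideals (order_S n (M_set n w))"
  by (auto simp: principal_ideal_def order_ideals_def order_S_def le_S_def intro: order_trans)

lemma principal_ideal_pmin:
  "principal_ideal n w (pmin x y) = principal_ideal n w x \<inter> principal_ideal n w y"
  by (auto simp: principal_ideal_def le_S_def)

lemma distributive_lattice_iso_code_region:
  assumes w: "w permutes {1..n}"
  shows "distributive_lattice_iso (ideal_lattice (order_S n (M_set n w)))
    (order_S n (code_region n w))"
proof -
  let ?P = "order_S n (M_set n w)"
  let ?L = "order_S n (code_region n w)"
  have fin: "finite I" and C: "ideal_code I \<in> code_region n w"
    if "I \<in> order_ideals ?P" for I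
  proof -
    have I: "I \<subseteq> M_set n w"
      using that by (simp add: order_ideals_def order_S_def)
    then show "finite I"
      using finite_M_set by (rule finite_subset)
    then show "ideal_code I \<in> code_region n w"
      using ideal_code_in_code_region I M_set_subset_code_region[OF w] by blast
  qed
  have "bij_betw ideal_code (order_ideals ?P) (code_region n w)"
    by (rule bij_betw_byWitness[where f' = "principal_ideal n w"])
      (auto simp: principal_ideal_code[OF w] ideal_code_principal[OF w] C
        principal_ideal_in_order_ideals)
  moreover have "ideal_code (I \<union> K) = pmax (ideal_code I) (ideal_code K)"
    if "I \<in> order_ideals ?P" "K \<in> order_ideals ?P" for I K
    using that fin by (intro ideal_code_Un)
  moreover have "ideal_code (I \<inter> K) = pmin (ideal_code I) (ideal_code K)"
    if "I \<in> order_ideals ?P" "K \<in> order_ideals ?P" for I K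
  proof -
    \<comment> \<open>A maximum over an intersection is not directly computable from the two maxima,
      so meets are transferred through the inverse map.\<close>
    have "I \<inter> K = principal_ideal n w (pmin (ideal_code I) (ideal_code K))"
      by (simp only: principal_ideal_pmin principal_ideal_code[OF w] that)
    then show ?thesis
      by (simp only: ideal_code_principal[OF w] code_region_pmin C that)
  qed
  moreover have "lattice (ideal_lattice ?P)" "lattice ?L"
    using distributive_lattice_ideal_lattice distributive_lattice_code_region
    by (blast intro: distributive_lattice.axioms)+
  ultimately show ?thesis
    unfolding distributive_lattice_iso_def join_pres_def meet_pres_def
    using distributive_lattice_ideal_lattice distributive_lattice_code_region C
    by (auto simp: carrier_ideal_lattice carrier_order_S join_code_region meet_code_region
        join_ideal_lattice meet_ideal_lattice intro!: exI[of _ ideal_code])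
qed

section \<open>Comparisons between the chains\<close>

lemma m_elem_not_le:
  assumes "i \<in> {1..n}" "x \<noteq> 0" "m_elem n w j y i = 0"
  shows "\<not> le_S n (m_elem n w i x) (m_elem n w j y)"
proof
  assume "le_S n (m_elem n w i x) (m_elem n w j y)"
  then have "m_elem n w i x i \<le> m_elem n w j y i"
    using assms(1) by (simp add: le_S_def)
  then show False
    using assms m_elem_self[OF assms(1), of w x] by simp
qed

theorem theorem4p14:
  fixes n :: nat and w :: "nat \<Rightarrow> nat"
  assumes "n \<ge> 1" and "w permutes {1..n}"
  shows
    "join_irreducibles (code_lattice n w) = M_set n w
   \<and> distributive_lattice_iso (ideal_lattice (order_S n (M_set n w))) (code_lattice n w)
   \<and> (\<forall>i \<in> {1..n}. \<forall>j \<in> {1..n}. \<forall>x \<in> {1..lehmer n w i}. \<forall>y \<in> {1..lehmer n w j}.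
        i < j \<longrightarrow> \<not> le_S n (m_elem n w i x) (m_elem n w j y))
   \<and> (\<forall>i j. (i, j) \<in> Inv n w \<longrightarrow>
        (\<forall>a \<in> C_chain n w i. \<forall>b \<in> C_chain n w j. \<not> le_S n a b \<and> \<not> le_S n b a))
   \<and> (\<forall>i j. (i, j) \<in> nonInv n w \<longrightarrow>
        (\<forall>x \<in> {1..lehmer n w i}. \<forall>y \<in> {1..lehmer n w j}.
          le_S n (m_elem n w j y) (m_elem n w i x)
            \<longleftrightarrow> int y \<le> int x - int (lehmer_ext n w i j)))"
proof (intro conjI)
  note w = assms(2)
  have L: "code_lattice n w = order_S n (code_region n w)"
    by (simp add: code_lattice_def codes_eq_code_region[OF w])
  show "join_irreducibles (code_lattice n w) = M_set n w"
    unfolding L by (rule join_irreducibles_code_region[OF w])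
  show "distributive_lattice_iso (ideal_lattice (order_S n (M_set n w))) (code_lattice n w)"
    unfolding L by (rule distributive_lattice_iso_code_region[OF w])
  show "\<forall>i \<in> {1..n}. \<forall>j \<in> {1..n}. \<forall>x \<in> {1..lehmer n w i}. \<forall>y \<in> {1..lehmer n w j}.
      i < j \<longrightarrow> \<not> le_S n (m_elem n w i x) (m_elem n w j y)"
    by (intro ballI impI m_elem_not_le) (auto simp: m_elem_def)
  show "\<forall>i j. (i, j) \<in> Inv n w \<longrightarrow>
      (\<forall>a \<in> C_chain n w i. \<forall>b \<in> C_chain n w j. \<not> le_S n a b \<and> \<not> le_S n b a)"
  proof (intro allI impI ballI)
    fix i j a b
    assume ij: "(i, j) \<in> Inv n w" and "a \<in> C_chain n w i" "b \<in> C_chain n w j"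
    then obtain x y where "a = m_elem n w i x" "x \<noteq> 0" "b = m_elem n w j y" "y \<noteq> 0"
      by (auto simp: C_chain_def)
    moreover have "i \<in> {1..n}" "j \<in> {1..n}" "i < j"
      using ij by (auto simp: Inv_def)
    \<comment> \<open>The first vanishes because \<open>i\<close> precedes \<open>j\<close>, the
      second because \<open>(i, j)\<close> is an inversion.\<close>
    moreover have "m_elem n w j y i = 0" "m_elem n w i x j = 0"
      using ij \<open>i < j\<close> by (simp_all add: m_elem_def)
    ultimately show "\<not> le_S n a b \<and> \<not> le_S n b a"
      using m_elem_not_le by blast
  qed
  show "\<forall>i j. (i, j) \<in> nonInv n w \<longrightarrow>
      (\<forall>x \<in> {1..lehmer n w i}. \<forall>y \<in> {1..lehmer n w j}.
        le_S n (m_elem n w j y) (m_elem n w i x)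
          \<longleftrightarrow> int y \<le> int x - int (lehmer_ext n w i j))"
  proof (intro allI impI ballI)
    fix i j x y
    assume ij: "(i, j) \<in> nonInv n w" and x: "x \<in> {1..lehmer n w i}" and y: "y \<in> {1..lehmer n w j}"
    have i: "i \<in> {1..n}"
      using ij by (simp add: nonInv_def)
    \<comment> \<open>A non-inversion may have \<open>j = Suc n\<close>, but the code is zero there
      and leaves no \<open>y\<close>.\<close>
    have j: "j \<in> {1..n}"
      using y lehmer_outside[of j n w] by force
    have "le_S n (m_elem n w j y) (m_elem n w i x) \<longleftrightarrow> y \<le> m_elem n w i x j"
      using m_elem_le_iff[OF w j m_elem_in_code_region[OF w i]] x by simp
    also have "m_elem n w i x j = x - lehmer_ext n w i j"
      using ij j by (auto simp: m_elem_def nonInv_iff[OF w])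
    \<comment> \<open>Truncated and integer subtraction agree in this comparison because
      \<open>y\<close> is positive.\<close>
    also have "y \<le> x - lehmer_ext n w i j \<longleftrightarrow> int y \<le> int x - int (lehmer_ext n w i j)"
      using y by auto
    finally show "le_S n (m_elem n w j y) (m_elem n w i x) \<longleftrightarrow>
        int y \<le> int x - int (lehmer_ext n w i j)" .
  qed
qed

end
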